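(* Let $N\in\mathbb{N}$ ($N\ge1$) and let $\omega\in\Omega$ be fixed. Suppose that $u^*$ is a solution to $\min_{u\in U}\{f(u)=\mathbb{E}[J(u,\xi)]+\Psi(u)\}$ and that $u_N^*=u_N^*(\omega)$ is a solution to $\min_{u\in U}\{f_N(u)=\frac1N\sum_{i=1}^N J(u,\xi^i(\omega))+\Psi(u)\}$. Assume: (a) $U$ is a real, separable Hilbert space; (b) $\Psi:U\to\mathbb{R}\cup\{\infty\}$ is convex, proper, and lower-semicontinuous; (c) $J:U\times\Xi\to\mathbb{R}$ is a Carathéodory function and, for some $\alpha>0$, $J(\cdot,\xi)$ is $\alpha$-strongly convex for each $\xi\in\Xi$; (d) $J(\cdot,\xi)$ is Gâteaux differentiable on a convex neighborhood of $\mathrm{dom}\,\Psi$ for all $\xi\in\Xi$, and $\nabla_u J(u^*,\cdot):\Xi\to U$ is measurable; (e) $F:U\to\mathbb{R}\cup\{\infty\}$, $F(u)=\mathbb{E}[J(u,\xi)]$, is Gâteaux differentiable at $u^*$. Let $F_N(u)=\frac1N\sum_{i=1}^N J(u,\xi^i(\omega))$. Then $$\alpha\|u^*-u_N^*\|_U\le\|\nabla F_N(u^* )-\nabla F(u^* )\|_U.$$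
   Context: Setting. $\Xi$ is a complete, separable metric space with its Borel $\sigma$-field; $\xi$ is a random element with values in $\Xi$ (the symbol $\xi$ also denotes a deterministic element of $\Xi$). $\xi^1,\xi^2,\ldots$ are independent identically distributed $\Xi$-valued random elements defined on a complete probability space $(\Omega,\mathcal{F},P)$, each with the same distribution as $\xi$. A solution to $\min_{u\in U} f(u)$ is a minimizer of $f$ with finite objective value. The function $F(u)=\mathbb{E}[J(u,\xi)]$ is taken to be well-defined with values in $\mathbb{R}\cup\{\infty\}$. Definitions. $\mathrm{dom}\,\Psi=\{u\in U:\Psi(u)<\infty\}$. A function $\mathsf{f}:U\to\mathbb{R}\cup\{\infty\}$ is $\alpha$-strongly convex ($\alpha>0$) if $\mathsf{f}(\cdot)-(\alpha/2)\|\cdot\|_U^2$ is convex. $J$ is a Carathéodory function if $J(\cdot,\xi)$ is continuous for every $\xi\in\Xi$ and $J(u,\cdot)$ is (Borel) measurable for every $u\in U$. Gradients $\nabla F$, $\nabla F_N$, $\nabla_u J$ (the last with respect to the first argument) are the elements of $U$ that represent the (bounded, linear) Gâteaux derivatives via the inner product of $U$. *)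

theory Defs
  imports "HOL-Probability.Probability"
begin

text \<open>
  Functions with values in \<open>\<real> \<union> {\<infinity>}\<close> are modelled as \<^typ>\<open>ereal\<close>-valued functions that never
  attain \<open>-\<infinity>\<close>. The product \<open>0 * \<infinity>\<close> is \<open>0\<close> in \<^typ>\<open>ereal\<close>, so the endpoints \<open>t = 0\<close> and \<open>t = 1\<close>
  impose nothing in the definition of convexity.
\<close>

definition eproper :: "('u \<Rightarrow> ereal) \<Rightarrow> bool" where
  "eproper f \<longleftrightarrow> (\<forall>u. f u \<noteq> -\<infinity>) \<and> (\<exists>u. f u \<noteq> \<infinity>)"

definition edom :: "('u \<Rightarrow> ereal) \<Rightarrow> 'u set" where
  "edom f = {u. f u < \<infinity>}"

definition econvex :: "('u::real_vector \<Rightarrow> ereal) \<Rightarrow> bool" where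
  "econvex f \<longleftrightarrow> (\<forall>u v. \<forall>t\<in>{0..1::real}.
     f (t *\<^sub>R u + (1 - t) *\<^sub>R v) \<le> ereal t * f u + ereal (1 - t) * f v)"

definition strongly_convex :: "real \<Rightarrow> ('u::real_normed_vector \<Rightarrow> ereal) \<Rightarrow> bool" where
  "strongly_convex \<alpha> f \<longleftrightarrow> econvex (\<lambda>u. f u - ereal (\<alpha> / 2 * (norm u)\<^sup>2))"

definition lower_semicontinuous :: "('u::topological_space \<Rightarrow> ereal) \<Rightarrow> bool" where
  "lower_semicontinuous f \<longleftrightarrow> (\<forall>u. f u \<le> Liminf (at u) f)"

definition caratheodory :: "('u::topological_space \<Rightarrow> 'x::topological_space \<Rightarrow> real) \<Rightarrow> bool" where
  "caratheodory J \<longleftrightarrow>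
     (\<forall>x. continuous_on UNIV (\<lambda>u. J u x)) \<and> (\<forall>u. (\<lambda>x. J u x) \<in> borel_measurable borel)"

definition is_solution :: "('u \<Rightarrow> ereal) \<Rightarrow> 'u \<Rightarrow> bool" where
  "is_solution f u \<longleftrightarrow> \<bar>f u\<bar> \<noteq> \<infinity> \<and> (\<forall>v. f u \<le> f v)"

text \<open>
  Since \<^const>\<open>ennreal\<close> sends negative numbers to \<open>0\<close>, the two integrals below are those of the
  positive and of the negative part of \<open>X\<close>. The expectation is well-defined with a value in
  \<open>\<real> \<union> {\<infinity>}\<close> precisely if the second one is finite.
\<close>

definition expectation_defined :: "'w measure \<Rightarrow> ('w \<Rightarrow> real) \<Rightarrow> bool" where
  "expectation_defined M X \<longleftrightarrow>
     X \<in> borel_measurable M \<and> (\<integral>\<^sup>+ w. ennreal (- X w) \<partial>M) < \<infinity>"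

definition ext_expectation :: "'w measure \<Rightarrow> ('w \<Rightarrow> real) \<Rightarrow> ereal" where
  "ext_expectation M X =
     enn2ereal (\<integral>\<^sup>+ w. ennreal (X w) \<partial>M) - enn2ereal (\<integral>\<^sup>+ w. ennreal (- X w) \<partial>M)"

text \<open>
  As the limit \<open>D h\<close> of the difference quotients is finite, \<open>f\<close> is automatically finite at
  \<open>u + t *\<^sub>R h\<close> for all small \<open>t\<close> (depending on \<open>h\<close>).
\<close>

definition has_gateaux_derivative ::
    "('u::real_normed_vector \<Rightarrow> ereal) \<Rightarrow> ('u \<Rightarrow> real) \<Rightarrow> 'u \<Rightarrow> bool" where
  "has_gateaux_derivative f D u \<longleftrightarrow> \<bar>f u\<bar> \<noteq> \<infinity> \<and> bounded_linear D \<and>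
     (\<forall>h. ((\<lambda>t::real. (f (u + t *\<^sub>R h) - f u) / ereal t) \<longlongrightarrow> ereal (D h)) (at 0))"

definition gateaux_differentiable :: "('u::real_normed_vector \<Rightarrow> ereal) \<Rightarrow> 'u \<Rightarrow> bool" where
  "gateaux_differentiable f u \<longleftrightarrow> (\<exists>D. has_gateaux_derivative f D u)"

definition gradient :: "('u::real_inner \<Rightarrow> ereal) \<Rightarrow> 'u \<Rightarrow> 'u" where
  "gradient f u = (THE g. has_gateaux_derivative f (\<lambda>h. inner g h) u)"

definition sample_average :: "('u \<Rightarrow> 'x \<Rightarrow> real) \<Rightarrow> (nat \<Rightarrow> 'x) \<Rightarrow> nat \<Rightarrow> 'u \<Rightarrow> real" where
  "sample_average J x N u = (1 / real N) * (\<Sum>i=1..N. J u (x i))"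

end

theory Submission
  imports Defs
begin

text \<open>
  Both problems are compared at the two points \<open>u_star\<close> and \<open>u_N\<close>. Write \<open>d\<close> for
  \<open>u_star - u_N\<close>. Three inequalities are added:

  \<^item> The optimality of \<open>u_star\<close> for \<open>F + \<Psi>\<close> and the convexity of \<open>\<Psi>\<close> give
    \<open>\<Psi> u_star - \<Psi> u_N \<le> - \<langle>\<nabla>F u_star, d\<rangle>\<close> (lemma \<open>first_order_optimality\<close>).

  \<^item> \<open>F_N + \<Psi>\<close> is strongly convex with minimizer \<open>u_N\<close>, so its value at \<open>u_star\<close> exceeds the
    minimum by at least \<open>\<alpha> / 2 * \<parallel>d\<parallel>\<^sup>2\<close> (lemma \<open>quadratic_growth_at_minimizer\<close>).

  \<^item> \<open>F_N\<close> lies above its tangent at \<open>u_star\<close> by the same quadratic term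
    (lemma \<open>strongly_convex_above_tangent\<close>).

  In the sum all function values cancel and
  \<open>\<alpha> * \<parallel>d\<parallel>\<^sup>2 \<le> \<langle>\<nabla>F_N u_star - \<nabla>F u_star, d\<rangle>\<close> is left; the Cauchy-Schwarz inequality concludes.

  The Gateaux derivatives can be written as inner products with the gradients because of the
  Riesz representation theorem (lemma \<open>riesz_representation\<close>), which is where the completeness
  of the space is used.
\<close>

section \<open>Gradients\<close>

text \<open>
  The representing element is the minimizer of \<open>\<phi> x = \<parallel>x\<parallel>\<^sup>2 / 2 - D x\<close>. It exists because
  the parallelogram identity makes every minimizing sequence a Cauchy sequence, and at a minimizer
  the derivative \<open>\<langle>g, h\<rangle> - D h\<close> of \<open>\<phi>\<close> vanishes.
\<close>

lemma riesz_representation: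
  fixes D :: "'u::{real_inner, complete_space} \<Rightarrow> real"
  assumes "bounded_linear D"
  obtains g where "D = (\<lambda>h. inner g h)"
proof -
  interpret D: bounded_linear D by fact
  define \<phi> where "\<phi> = (\<lambda>x. (norm x)\<^sup>2 / 2 - D x)"
  obtain K where K: "\<And>x. norm (D x) \<le> norm x * K"
    using D.bounded by blast
  have "- K\<^sup>2 / 2 \<le> \<phi> x" for x
  proof -
    have "D x \<le> norm x * K"
      using K[of x] by simp
    moreover have "0 \<le> (norm x - K)\<^sup>2"
      by simp
    ultimately show ?thesis
      by (simp add: \<phi>_def power2_diff)
  qed
  then have bdd: "bdd_below (range \<phi>)"
    by (intro bdd_belowI) auto
  define m where "m = (INF x. \<phi> x)"
  have m_le: "m \<le> \<phi> x" for x
    unfolding m_def using bdd by (rule cINF_lower) simp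
  have "\<exists>x. \<phi> x < m + inverse (real (Suc n))" for n
    using cINF_less_iff[OF _ bdd, of "m + inverse (real (Suc n))"] by (auto simp: m_def)
  then obtain X where X: "\<And>n. \<phi> (X n) < m + inverse (real (Suc n))"
    by metis
  have mid: "(norm (x - y))\<^sup>2 / 4 \<le> (\<phi> x - m) + (\<phi> y - m)" for x y
  proof -
    have "D ((1/2) *\<^sub>R (x + y)) = (D x + D y) / 2"
      by (simp add: D.scaleR D.add)
    moreover have "(norm ((1/2) *\<^sub>R (x + y)))\<^sup>2 = (norm x)\<^sup>2 / 2 + (norm y)\<^sup>2 / 2 - (norm (x - y))\<^sup>2 / 4"
      by (simp add: power2_norm_eq_inner inner_simps inner_commute field_simps)
    ultimately have "2 * \<phi> ((1/2) *\<^sub>R (x + y)) = \<phi> x + \<phi> y - (norm (x - y))\<^sup>2 / 4"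
      by (simp add: \<phi>_def field_simps)
    with m_le[of "(1/2) *\<^sub>R (x + y)"] show ?thesis
      by simp
  qed
  have "Cauchy X"
  proof (rule metric_CauchyI)
    fix e :: real
    assume e: "0 < e"
    then obtain N where N: "inverse (real (Suc N)) < e\<^sup>2 / 8"
      using reals_Archimedean[of "e\<^sup>2 / 8"] by auto
    have close: "\<phi> (X n) - m < e\<^sup>2 / 8" if "n \<ge> N" for n
    proof -
      have "inverse (real (Suc n)) \<le> inverse (real (Suc N))"
        using that by (intro le_imp_inverse_le) auto
      with X[of n] N show ?thesis
        by linarith
    qed
    have "dist (X i) (X j) < e" if "i \<ge> N" "j \<ge> N" for i j
    proof -
      have "(norm (X i - X j))\<^sup>2 < e\<^sup>2"
        using mid[of "X i" "X j"] close[OF that(1)] close[OF that(2)] by simp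
      with e show ?thesis
        by (simp add: dist_norm power2_less_imp_less)
    qed
    then show "\<exists>N. \<forall>i\<ge>N. \<forall>j\<ge>N. dist (X i) (X j) < e"
      by blast
  qed
  then obtain g where g: "X \<longlonglongrightarrow> g"
    using Cauchy_convergent convergent_def by blast
  have "(\<lambda>n. \<phi> (X n)) \<longlonglongrightarrow> \<phi> g"
    unfolding \<phi>_def by (intro tendsto_intros D.tendsto g) simp
  moreover have "(\<lambda>n. m + inverse (real (Suc n))) \<longlonglongrightarrow> m + 0"
    by (intro tendsto_intros LIMSEQ_inverse_real_of_nat)
  ultimately have "\<phi> g \<le> m + 0"
    by (rule LIMSEQ_le) (use X less_imp_le in blast)
  then have min: "\<phi> g \<le> \<phi> x" for x
    using m_le[of x] by simp
  have "D h = inner g h" for h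
  proof (rule ccontr)
    define c where "c = inner g h - D h"
    assume "D h \<noteq> inner g h"
    then have c: "c \<noteq> 0"
      by (simp add: c_def)
    then have h: "h \<noteq> 0"
      by (auto simp: c_def D.zero)
    \<comment> \<open>this step minimizes the quadratic function of \<open>t\<close> below\<close>
    define t where "t = - c / (norm h)\<^sup>2"
    have "(norm (g + t *\<^sub>R h))\<^sup>2 = (norm g)\<^sup>2 + 2 * t * inner g h + t\<^sup>2 * (norm h)\<^sup>2"
      unfolding power2_norm_eq_inner
      by (simp add: inner_simps inner_commute power2_eq_square algebra_simps)
    then have "\<phi> (g + t *\<^sub>R h) = \<phi> g + t * c + t\<^sup>2 * (norm h)\<^sup>2 / 2"
      by (simp add: \<phi>_def c_def D.add D.scaleR field_simps)
    also have "\<dots> = \<phi> g - c\<^sup>2 / (2 * (norm h)\<^sup>2)"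
      using h by (simp add: t_def field_simps power2_eq_square)
    also have "\<dots> < \<phi> g"
      using c h by simp
    finally show False
      using min[of "g + t *\<^sub>R h"] by simp
  qed
  then show ?thesis
    using that by blast
qed

lemma inner_gradient_eq:
  fixes f :: "'u::{real_inner, complete_space} \<Rightarrow> ereal"
  assumes "has_gateaux_derivative f D u"
  shows "inner (gradient f u) h = D h"
proof -
  obtain g where g: "D = (\<lambda>h. inner g h)"
    using assms riesz_representation unfolding has_gateaux_derivative_def by blast
  have "gradient f u = g"
    unfolding gradient_def
  proof (rule the_equality)
    show "has_gateaux_derivative f (\<lambda>h. inner g h) u"
      using assms by (simp add: g)
    fix g'
    assume g': "has_gateaux_derivative f (\<lambda>h. inner g' h) u"
    have "inner g' h = inner g h" for h
      using tendsto_unique[OF trivial_limit_at] assms g'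
      unfolding has_gateaux_derivative_def g ereal.inject[symmetric] by blast
    then show "g' = g"
      by (metis inner_commute vector_eq_rdot)
  qed
  then show ?thesis
    by (simp add: g)
qed

lemma has_gateaux_derivative_ereal_iff:
  fixes g :: "'u::real_normed_vector \<Rightarrow> real"
  shows "has_gateaux_derivative (\<lambda>u. ereal (g u)) D u \<longleftrightarrow>
    bounded_linear D \<and> (\<forall>h. ((\<lambda>t. (g (u + t *\<^sub>R h) - g u) / t) \<longlongrightarrow> D h) (at 0))"
proof -
  have "((\<lambda>t. (ereal (g (u + t *\<^sub>R h)) - ereal (g u)) / ereal t) \<longlongrightarrow> ereal (D h)) (at 0) \<longleftrightarrow>
        ((\<lambda>t. ereal ((g (u + t *\<^sub>R h) - g u) / t)) \<longlongrightarrow> ereal (D h)) (at 0)" for h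
    by (rule tendsto_cong) (auto simp: eventually_at_filter)
  then show ?thesis
    by (simp add: has_gateaux_derivative_def)
qed

lemma gateaux_differentiable_sample_average:
  fixes J :: "'u::real_normed_vector \<Rightarrow> 'x \<Rightarrow> real"
  assumes "\<And>i. gateaux_differentiable (\<lambda>u. ereal (J u (x i))) u"
  shows "gateaux_differentiable (\<lambda>u. ereal (sample_average J x N u)) u"
proof -
  obtain D where D: "\<And>i. has_gateaux_derivative (\<lambda>u. ereal (J u (x i))) (D i) u"
    using assms unfolding gateaux_differentiable_def by metis
  let ?D = "\<lambda>h. (1 / real N) * (\<Sum>i=1..N. D i h)"
  have "bounded_linear ?D"
    using D by (intro bounded_linear_const_mult bounded_linear_sum)
      (auto simp: has_gateaux_derivative_ereal_iff)
  moreover have "((\<lambda>t. (sample_average J x N (u + t *\<^sub>R h) - sample_average J x N u) / t)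
      \<longlongrightarrow> ?D h) (at 0)" for h
  proof -
    have "((\<lambda>t. (1 / real N) * (\<Sum>i=1..N. (J (u + t *\<^sub>R h) (x i) - J u (x i)) / t)) \<longlongrightarrow> ?D h) (at 0)"
      using D by (intro tendsto_intros) (auto simp: has_gateaux_derivative_ereal_iff)
    then show ?thesis
      by (simp add: sample_average_def sum_subtractf sum_divide_distrib[symmetric]
          right_diff_distrib diff_divide_distrib)
  qed
  ultimately show ?thesis
    unfolding gateaux_differentiable_def has_gateaux_derivative_ereal_iff by blast
qed

section \<open>Convexity and optimality\<close>

lemma convex_combination_eq_line:
  fixes u v :: "'u::real_vector"
  shows "t *\<^sub>R v + (1 - t) *\<^sub>R u = u + t *\<^sub>R (v - u)"
  by (simp add: algebra_simps)

text \<open>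
  In an inner product space, subtracting \<open>\<alpha> / 2 * \<parallel>u\<parallel>\<^sup>2\<close> costs exactly the term
  \<open>\<alpha> / 2 * t * (1 - t) * \<parallel>v - u\<parallel>\<^sup>2\<close> in the convexity inequality; this is the form of strong
  convexity that can be averaged and tested along segments.
\<close>

lemma strongly_convexD:
  fixes g :: "'u::real_inner \<Rightarrow> real"
  assumes "strongly_convex \<alpha> (\<lambda>u. ereal (g u))" and "0 \<le> t" and "t \<le> 1"
  shows "g (u + t *\<^sub>R (v - u)) \<le> t * g v + (1 - t) * g u - \<alpha> / 2 * t * (1 - t) * (norm (v - u))\<^sup>2"
proof -
  have "g (t *\<^sub>R v + (1 - t) *\<^sub>R u) - \<alpha> / 2 * (norm (t *\<^sub>R v + (1 - t) *\<^sub>R u))\<^sup>2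
      \<le> t * (g v - \<alpha> / 2 * (norm v)\<^sup>2) + (1 - t) * (g u - \<alpha> / 2 * (norm u)\<^sup>2)"
    using assms unfolding strongly_convex_def econvex_def by auto
  moreover have "(norm (t *\<^sub>R v + (1 - t) *\<^sub>R u))\<^sup>2
      = t * (norm v)\<^sup>2 + (1 - t) * (norm u)\<^sup>2 - t * (1 - t) * (norm (v - u))\<^sup>2"
    unfolding power2_norm_eq_inner by (simp add: inner_simps inner_commute algebra_simps)
  ultimately have "g (t *\<^sub>R v + (1 - t) *\<^sub>R u)
      - \<alpha> / 2 * (t * (norm v)\<^sup>2 + (1 - t) * (norm u)\<^sup>2 - t * (1 - t) * (norm (v - u))\<^sup>2)
      \<le> t * (g v - \<alpha> / 2 * (norm v)\<^sup>2) + (1 - t) * (g u - \<alpha> / 2 * (norm u)\<^sup>2)"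
    by (simp only:)
  then show ?thesis
    unfolding convex_combination_eq_line by (simp add: field_simps)
qed

lemma strongly_convex_sample_average:
  fixes J :: "'u::real_inner \<Rightarrow> 'x \<Rightarrow> real"
  assumes "\<And>i. strongly_convex \<alpha> (\<lambda>u. ereal (J u (x i)))" and "N \<ge> 1"
  shows "strongly_convex \<alpha> (\<lambda>u. ereal (sample_average J x N u))"
proof -
  let ?q = "\<lambda>u. \<alpha> / 2 * (norm u)\<^sup>2"
  \<comment> \<open>the weights of the average sum to \<open>1\<close>, so the quadratic term can be moved inside\<close>
  have avg: "sample_average J x N u - ?q u = (1 / real N) * (\<Sum>i=1..N. J u (x i) - ?q u)" for u
    using assms(2) by (simp only: sample_average_def sum_subtractf) (simp add: right_diff_distrib)
  have "sample_average J x N w - ?q w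
      \<le> t * (sample_average J x N u - ?q u) + (1 - t) * (sample_average J x N v - ?q v)"
    if t: "t \<in> {0..1}" and w: "w = t *\<^sub>R u + (1 - t) *\<^sub>R v" for u v w t
  proof -
    have "J w (x i) - ?q w \<le> t * (J u (x i) - ?q u) + (1 - t) * (J v (x i) - ?q v)" for i
      using assms(1)[of i] t unfolding strongly_convex_def econvex_def w by auto
    then have "(\<Sum>i=1..N. J w (x i) - ?q w)
        \<le> (\<Sum>i=1..N. t * (J u (x i) - ?q u) + (1 - t) * (J v (x i) - ?q v))"
      by (intro sum_mono)
    also have "\<dots> = t * (\<Sum>i=1..N. J u (x i) - ?q u) + (1 - t) * (\<Sum>i=1..N. J v (x i) - ?q v)"
      by (simp only: sum.distrib sum_distrib_left)
    finally have "(1 / real N) * (\<Sum>i=1..N. J w (x i) - ?q w)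
        \<le> (1 / real N) * (t * (\<Sum>i=1..N. J u (x i) - ?q u) + (1 - t) * (\<Sum>i=1..N. J v (x i) - ?q v))"
      by (rule mult_left_mono) simp
    then show ?thesis
      unfolding avg by (simp add: algebra_simps diff_divide_distrib)
  qed
  then show ?thesis
    unfolding strongly_convex_def econvex_def by simp
qed

text \<open>
  Strong convexity bounds the difference quotients of \<open>g\<close> in direction \<open>v - u\<close>; the limit
  \<open>t \<rightarrow> 0\<close> gives the bound for the derivative.
\<close>

lemma strongly_convex_above_tangent:
  fixes g :: "'u::real_inner \<Rightarrow> real"
  assumes "strongly_convex \<alpha> (\<lambda>u. ereal (g u))"
    and "has_gateaux_derivative (\<lambda>u. ereal (g u)) D u"
  shows "g u + D (v - u) + \<alpha> / 2 * (norm (v - u))\<^sup>2 \<le> g v"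
proof -
  let ?b = "\<lambda>t. g v - g u - \<alpha> / 2 * (1 - t) * (norm (v - u))\<^sup>2"
  have lim: "((\<lambda>t. (g (u + t *\<^sub>R (v - u)) - g u) / t) \<longlongrightarrow> D (v - u)) (at_right 0)"
    using assms(2) unfolding has_gateaux_derivative_ereal_iff
    by (blast intro: filterlim_at_split[THEN iffD1, THEN conjunct2])
  have "(?b \<longlongrightarrow> g v - g u - \<alpha> / 2 * (1 - 0) * (norm (v - u))\<^sup>2) (at_right 0)"
    by (intro tendsto_intros)
  moreover have "eventually (\<lambda>t. (g (u + t *\<^sub>R (v - u)) - g u) / t \<le> ?b t) (at_right 0)"
    using eventually_at_right_real[OF zero_less_one]
  proof eventually_elim
    case (elim t)
    then show ?case
      using strongly_convexD[OF assms(1), of t u v] by (simp add: field_simps)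
  qed
  ultimately have "D (v - u) \<le> g v - g u - \<alpha> / 2 * (1 - 0) * (norm (v - u))\<^sup>2"
    using lim by (intro tendsto_le[OF trivial_limit_at_right_real])
  then show ?thesis
    by simp
qed

lemma econvex_on_line:
  assumes "econvex \<Psi>" and "\<Psi> u = ereal a" and "\<Psi> v = ereal b" and "0 \<le> t" and "t \<le> 1"
  shows "\<Psi> (u + t *\<^sub>R (v - u)) \<le> ereal (t * b + (1 - t) * a)"
proof -
  have "\<Psi> (t *\<^sub>R v + (1 - t) *\<^sub>R u) \<le> ereal t * \<Psi> v + ereal (1 - t) * \<Psi> u"
    using assms(1,4,5) unfolding econvex_def by auto
  then show ?thesis
    using assms(2,3) by (simp add: convex_combination_eq_line)
qed

text \<open>
  The minimum is compared with the value at \<open>u + t *\<^sub>R (v - u)\<close>. The gain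
  \<open>\<alpha> / 2 * t * (1 - t) * \<parallel>v - u\<parallel>\<^sup>2\<close> from strong convexity is divided by \<open>t\<close>; in the limit
  \<open>t \<rightarrow> 0\<close> the full constant \<open>\<alpha> / 2\<close> remains.
\<close>

lemma quadratic_growth_at_minimizer:
  fixes g :: "'u::real_inner \<Rightarrow> real"
  assumes "strongly_convex \<alpha> (\<lambda>u. ereal (g u))" and "econvex \<Psi>"
    and "\<And>w. ereal (g u) + \<Psi> u \<le> ereal (g w) + \<Psi> w"
    and a: "\<Psi> u = ereal a" and b: "\<Psi> v = ereal b"
  shows "g u + a + \<alpha> / 2 * (norm (v - u))\<^sup>2 \<le> g v + b"
proof -
  have "((\<lambda>t. \<alpha> / 2 * (1 - t) * (norm (v - u))\<^sup>2) \<longlongrightarrow> \<alpha> / 2 * (1 - 0) * (norm (v - u))\<^sup>2) (at_right 0)"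
    by (intro tendsto_intros)
  moreover have "eventually (\<lambda>t. \<alpha> / 2 * (1 - t) * (norm (v - u))\<^sup>2 \<le> g v + b - g u - a) (at_right 0)"
    using eventually_at_right_real[OF zero_less_one]
  proof eventually_elim
    case (elim t)
    define w where "w = u + t *\<^sub>R (v - u)"
    have "ereal (g u + a) \<le> ereal (g w) + \<Psi> w"
      using assms(3)[of w] by (simp add: a)
    also have "\<dots> \<le> ereal (g w) + ereal (t * b + (1 - t) * a)"
      unfolding w_def using elim by (intro add_left_mono econvex_on_line assms) auto
    finally have "g u + a \<le> g w + (t * b + (1 - t) * a)"
      by simp
    moreover have "g w \<le> t * g v + (1 - t) * g u - \<alpha> / 2 * t * (1 - t) * (norm (v - u))\<^sup>2"
      unfolding w_def using elim by (intro strongly_convexD assms) auto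
    ultimately have "t * (\<alpha> / 2 * (1 - t) * (norm (v - u))\<^sup>2) \<le> t * (g v + b - g u - a)"
      by (simp add: algebra_simps)
    then show ?case
      using elim by simp
  qed
  ultimately have "\<alpha> / 2 * (1 - 0) * (norm (v - u))\<^sup>2 \<le> g v + b - g u - a"
    by (intro tendsto_upperbound[OF _ _ trivial_limit_at_right_real])
  then show ?thesis
    by simp
qed

text \<open>
  The convexity of \<open>\<Psi>\<close> bounds its increment along the segment linearly, so only \<open>f\<close> has to
  be differentiated. The function \<open>f\<close> may take infinite values away from \<open>u\<close>.
\<close>

lemma first_order_optimality:
  fixes f :: "'u::real_normed_vector \<Rightarrow> ereal"
  assumes "has_gateaux_derivative f D u" and "econvex \<Psi>"
    and "\<And>w. f u + \<Psi> u \<le> f w + \<Psi> w"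
    and a: "\<Psi> u = ereal a" and b: "\<Psi> v = ereal b"
  shows "a - b \<le> D (v - u)"
proof -
  obtain c where c: "f u = ereal c"
    using assms(1) unfolding has_gateaux_derivative_def by (cases "f u") auto
  have "((\<lambda>t. (f (u + t *\<^sub>R (v - u)) - f u) / ereal t) \<longlongrightarrow> ereal (D (v - u))) (at_right 0)"
    using assms(1) unfolding has_gateaux_derivative_def
    by (blast intro: filterlim_at_split[THEN iffD1, THEN conjunct2])
  moreover have "eventually (\<lambda>t. ereal (a - b) \<le> (f (u + t *\<^sub>R (v - u)) - f u) / ereal t) (at_right 0)"
    using eventually_at_right_real[OF zero_less_one]
  proof eventually_elim
    case (elim t)
    define w where "w = u + t *\<^sub>R (v - u)"
    have "ereal (c + a) \<le> f w + \<Psi> w"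
      using assms(3)[of w] by (simp add: a c)
    also have "\<dots> \<le> f w + ereal (t * b + (1 - t) * a)"
      unfolding w_def using elim by (intro add_left_mono econvex_on_line assms) auto
    finally have "ereal (c + a) \<le> f w + ereal (t * b + (1 - t) * a)" .
    then have "ereal (a - b) \<le> (f w - ereal c) / ereal t"
      using elim by (cases "f w") (auto simp: field_simps)
    then show ?case
      by (simp add: w_def c)
  qed
  ultimately have "ereal (a - b) \<le> ereal (D (v - u))"
    by (intro tendsto_lowerbound[OF _ _ trivial_limit_at_right_real])
  then show ?thesis
    by simp
qed

section \<open>Stability of the minimizers\<close>

text \<open>
  The error estimate for two arbitrary objectives: \<open>f\<close> stands for the expectation and \<open>g\<close> for
  its sample average.
\<close>

lemma minimizer_distance_le_gradient_difference:
  fixes f :: "'u::{real_inner, complete_space} \<Rightarrow> ereal" and g :: "'u \<Rightarrow> real"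
  assumes "econvex \<Psi>" and "strongly_convex \<alpha> (\<lambda>u. ereal (g u))"
    and "gateaux_differentiable f u" and "gateaux_differentiable (\<lambda>u. ereal (g u)) u"
    and "\<And>w. f u + \<Psi> u \<le> f w + \<Psi> w" and "\<And>w. ereal (g v) + \<Psi> v \<le> ereal (g w) + \<Psi> w"
    and "\<bar>\<Psi> u\<bar> \<noteq> \<infinity>" and "\<bar>\<Psi> v\<bar> \<noteq> \<infinity>"
  shows "\<alpha> * norm (u - v) \<le> norm (gradient (\<lambda>u. ereal (g u)) u - gradient f u)"
proof -
  obtain a b where a: "\<Psi> u = ereal a" and b: "\<Psi> v = ereal b"
    using assms(7,8) by auto
  obtain D where D: "has_gateaux_derivative f D u"
    using assms(3) unfolding gateaux_differentiable_def by blast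
  obtain E where E: "has_gateaux_derivative (\<lambda>u. ereal (g u)) E u"
    using assms(4) unfolding gateaux_differentiable_def by blast
  let ?p = "gradient (\<lambda>u. ereal (g u)) u" and ?q = "gradient f u"
  have "a - b \<le> inner ?q (v - u)"
    using first_order_optimality[OF D assms(1,5) a b] by (simp add: inner_gradient_eq[OF D])
  moreover have "g v + b + \<alpha> / 2 * (norm (u - v))\<^sup>2 \<le> g u + a"
    by (rule quadratic_growth_at_minimizer[OF assms(2,1,6) b a])
  moreover have "g u + inner ?p (v - u) + \<alpha> / 2 * (norm (u - v))\<^sup>2 \<le> g v"
    using strongly_convex_above_tangent[OF assms(2) E, of v]
    by (simp add: inner_gradient_eq[OF E] norm_minus_commute)
  ultimately have "\<alpha> * (norm (u - v))\<^sup>2 \<le> inner (?p - ?q) (u - v)"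
    by (simp add: inner_simps)
  also have "\<dots> \<le> norm (?p - ?q) * norm (u - v)"
    by (rule norm_cauchy_schwarz)
  finally show ?thesis
    by (cases "u = v") (simp_all add: power2_eq_square)
qed

theorem lemma6:
  fixes M :: "'w measure" and M0 :: "'v measure"
    and \<xi>0 :: "'v \<Rightarrow> 'x::polish_space" and \<xi> :: "nat \<Rightarrow> 'w \<Rightarrow> 'x"
    and J :: "'u::{real_inner, polish_space} \<Rightarrow> 'x \<Rightarrow> real"
    and \<Psi> :: "'u \<Rightarrow> ereal" and F :: "'u \<Rightarrow> ereal" and F_N :: "'u \<Rightarrow> real"
    and \<alpha> :: real and N :: nat and \<omega> :: 'w and u_star u_N :: 'u
  assumes "prob_space M" and "complete_measure M"
    and "prob_space M0" and "\<xi>0 \<in> measurable M0 borel"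
    and "prob_space.indep_vars M (\<lambda>_. borel) \<xi> {1..}"
    and "\<And>i. i \<ge> 1 \<Longrightarrow> distr M borel (\<xi> i) = distr M0 borel \<xi>0"
    and "N \<ge> 1" and "\<omega> \<in> space M"
    and F_def: "F = (\<lambda>u. ext_expectation M0 (\<lambda>v. J u (\<xi>0 v)))"
    and F_N_def: "F_N = sample_average J (\<lambda>i. \<xi> i \<omega>) N"
    and "\<And>u. expectation_defined M0 (\<lambda>v. J u (\<xi>0 v))"
    and "is_solution (\<lambda>u. F u + \<Psi> u) u_star"
    and "is_solution (\<lambda>u. ereal (F_N u) + \<Psi> u) u_N"
    and "econvex \<Psi>" and "eproper \<Psi>" and "lower_semicontinuous \<Psi>"
    and "caratheodory J"
    and "\<alpha> > 0" and "\<And>x. strongly_convex \<alpha> (\<lambda>u. ereal (J u x))"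
    and "\<And>x. \<exists>V. open V \<and> convex V \<and> edom \<Psi> \<subseteq> V \<and>
               (\<forall>u\<in>V. gateaux_differentiable (\<lambda>u. ereal (J u x)) u)"
    and "(\<lambda>x. gradient (\<lambda>u. ereal (J u x)) u_star) \<in> borel_measurable borel"
    and "gateaux_differentiable F u_star"
  shows "\<alpha> * norm (u_star - u_N)
           \<le> norm (gradient (\<lambda>u. ereal (F_N u)) u_star - gradient F u_star)"
proof -
  \<comment> \<open>the negative part of \<open>J u (\<xi>0 v)\<close> has a finite integral\<close>
  have F_ninfty: "F u \<noteq> -\<infinity>" for u
    using assms(11)[of u] enn2ereal_nonneg[of "\<integral>\<^sup>+ v. ennreal (J u (\<xi>0 v)) \<partial>M0"]
    unfolding F_def ext_expectation_def expectation_defined_def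
    by (cases "\<integral>\<^sup>+ v. ennreal (J u (\<xi>0 v)) \<partial>M0"; cases "\<integral>\<^sup>+ v. ennreal (- J u (\<xi>0 v)) \<partial>M0") auto
  have \<Psi>_ninfty: "\<Psi> u \<noteq> -\<infinity>" for u
    using \<open>eproper \<Psi>\<close> unfolding eproper_def by blast
  have fin_u: "\<bar>\<Psi> u_star\<bar> \<noteq> \<infinity>"
    using \<open>is_solution (\<lambda>u. F u + \<Psi> u) u_star\<close> F_ninfty[of u_star] \<Psi>_ninfty[of u_star]
    unfolding is_solution_def by (cases "F u_star"; cases "\<Psi> u_star") auto
  have fin_v: "\<bar>\<Psi> u_N\<bar> \<noteq> \<infinity>"
    using \<open>is_solution (\<lambda>u. ereal (F_N u) + \<Psi> u) u_N\<close>
    unfolding is_solution_def by (cases "\<Psi> u_N") auto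
  have "u_star \<in> edom \<Psi>"
    using fin_u by (cases "\<Psi> u_star") (auto simp: edom_def)
  then have "gateaux_differentiable (\<lambda>u. ereal (J u x)) u_star" for x
    using assms(20)[of x] by blast
  then have "gateaux_differentiable (\<lambda>u. ereal (F_N u)) u_star"
    unfolding F_N_def by (intro gateaux_differentiable_sample_average)
  moreover have "strongly_convex \<alpha> (\<lambda>u. ereal (F_N u))"
    unfolding F_N_def by (intro strongly_convex_sample_average assms)
  ultimately show ?thesis
    using assms(12,13) unfolding is_solution_def
    by (intro minimizer_distance_le_gradient_difference[where \<Psi> = \<Psi>] assms fin_u fin_v) auto
qed

end
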